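(* Let $d\ge1$ and let $0=u_0<u_1<\dots<u_m=1$ and $0=v_0<v_1<\dots<v_n=1$ be partitions of $[0,1]$. Let $x^1_{u,v}\in\mathbb R^d$ and $x^2_{u,v}=(x^{(i,j)}_{u,v})\in\mathbb R^{d\times d}$ be functions of $(u,v)\in[0,1]^2$ depending only on $u$ and constant on each interval of the first partition; let $y^1_{u,v}\in\mathbb R^d$ and $y^2_{u,v}=(y^{(i,j)}_{u,v})\in\mathbb R^{d\times d}$ depend only on $v$ and be constant on each interval of the second partition; $x^2,y^2$ are antisymmetric matrices (i.e. $(0,x^1,x^2)$ and $(0,y^1,y^2)$ take values in the step-2 free Lie algebra over $\mathbb R^d$, as step-2 log-signatures do). Define $$\alpha_j=\sum_{i=1}^dx^{(j,i)}y^{(i)},\quad \beta_j=\sum_{i=1}^dx^{(i)}y^{(j,i)},\quad \gamma=\sum_{i=1}^dx^{(i)}y^{(i)}+\sum_{i,j=1}^dx^{(i,j)}y^{(i,j)},$$ where $x^{(i)},y^{(i)}$ are the coordinates of $x^1,y^1$. Let $a,b\in\mathbb R^d$ and $h_0\equiv(1,a,b)$, a constant function on $[0,1]^2$ with values in $\mathbb R^{2d+1}$. Assume there are constants $M,K_1,\dots,K_7$ such that for all $s,t\in[0,1]$ $$\|h_0(s,t)\|\le M,\ |\gamma_{s,t}|\le K_1,\ \|\alpha_{s,t}\|\le K_2,\ \|\beta_{s,t}\|\le K_3,$$ $$\|x^1_{s,t}\|\le K_4,\ \|y^1_{s,t}\|\le K_5,\ \|x^2_{s,t}\|_{\mathrm{op}}\le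 K_6,\ \|y^2_{s,t}\|_{\mathrm{op}}\le K_7 .$$ Then the system of PDEs $$\frac{\partial^2f}{\partial u\partial v}=\gamma f+\alpha^\top\varphi+\beta^\top\psi,\qquad \frac{\partial\varphi}{\partial v}=f\,y^1+(y^2)^\top\psi,\qquad \frac{\partial\psi}{\partial u}=f\,x^1+(x^2)^\top\varphi$$ for $f:[0,1]^2\to\mathbb R$, $\varphi,\psi:[0,1]^2\to\mathbb R^d$, understood in the integrated form $(\mathrm{id}-\mathcal T)\Phi=h_0$ with $\Phi=(f,\varphi,\psi)$, admits a unique solution $\Phi\in C([0,1]^2,\mathbb R^{2d+1})$.
   Context: For $h\in C([0,1]^2,\mathbb R^{2d+1})$ write $[h]_1\in\mathbb R$, $[h]_{2:d+1}\in\mathbb R^d$, $[h]_{d+2:2d+1}\in\mathbb R^d$ for its blocks. The integral operator $\mathcal T$ on $C([0,1]^2,\mathbb R^{2d+1})$ (with the sup norm) is $$[\mathcal Th(s,t)]_1=\int_0^s\!\!\int_0^t\big(\gamma_{u,v}[h(u,v)]_1+\alpha_{u,v}^\top[h(u,v)]_{2:d+1}+\beta_{u,v}^\top[h(u,v)]_{d+2:2d+1}\big)\,dv\,du,$$ $$[\mathcal Th(s,t)]_{2:d+1}=\int_0^t\big([h(s,v)]_1\,y^1_{s,v}+(y^2_{s,v})^\top[h(s,v)]_{d+2:2d+1}\big)\,dv,$$ $$[\mathcal Th(s,t)]_{d+2:2d+1}=\int_0^s\big([h(u,t)]_1\,x^1_{u,t}+(x^2_{u,t})^\top[h(u,t)]_{2:d+1}\big)\,du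 .$$ $\|\cdot\|_{\mathrm{op}}$ is the operator norm of a matrix. *)

theory Defs
  imports "HOL-Analysis.Analysis"
begin

text \<open>
  The space \<open>\<real>\<^sup>2\<^sup>d\<^sup>+\<^sup>1\<close>, together with its three blocks of sizes \<open>1\<close>, \<open>d\<close>, \<open>d\<close>, is the product
  below; the library norm on products is the Euclidean one.
\<close>

type_synonym 'd state = "real \<times> (real ^ 'd) \<times> (real ^ 'd)"

abbreviation unit_square :: "(real \<times> real) set" where
  "unit_square \<equiv> {0..1} \<times> {0..1}"

text \<open>
  Membership in \<open>extensional\<close> fixes the (irrelevant) values outside the square, so that elements of
  this set correspond exactly to continuous functions on the square.
\<close>

definition C_square :: "(real \<times> real \<Rightarrow> 'b::topological_space) set" where
  "C_square = {h \<in> extensional unit_square. continuous_on unit_square h}"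

definition partition01 :: "nat \<Rightarrow> (nat \<Rightarrow> real) \<Rightarrow> bool" where
  "partition01 m p \<longleftrightarrow> p 0 = 0 \<and> p m = 1 \<and> (\<forall>i<m. p i < p (Suc i))"

text \<open>
  \<open>f r w\<close> depends only on \<open>r\<close> and is piecewise constant in \<open>r\<close>. Constancy is required on the open
  intervals only; the values at the partition points are arbitrary, which covers both
  conventions for half-open intervals.
\<close>

definition step_in_first :: "nat \<Rightarrow> (nat \<Rightarrow> real) \<Rightarrow> (real \<Rightarrow> real \<Rightarrow> 'b) \<Rightarrow> bool" where
  "step_in_first m p f \<longleftrightarrow>
     (\<forall>r\<in>{0..1}. (\<lambda>w. f r w) constant_on {0..1}) \<and>
     (\<forall>i<m. \<forall>w\<in>{0..1}. (\<lambda>r. f r w) constant_on {p i<..<p (Suc i)})"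

definition step_in_second :: "nat \<Rightarrow> (nat \<Rightarrow> real) \<Rightarrow> (real \<Rightarrow> real \<Rightarrow> 'b) \<Rightarrow> bool" where
  "step_in_second n p f \<longleftrightarrow> step_in_first n p (\<lambda>v u. f u v)"

definition antisymmetric_matrix :: "real ^ 'd ^ 'd \<Rightarrow> bool" where
  "antisymmetric_matrix A \<longleftrightarrow> transpose A = - A"

definition alpha_coeff ::
  "(real \<Rightarrow> real \<Rightarrow> real ^ 'd ^ 'd) \<Rightarrow> (real \<Rightarrow> real \<Rightarrow> real ^ 'd) \<Rightarrow> real \<Rightarrow> real \<Rightarrow> real ^ 'd" where
  "alpha_coeff x2 y1 u v = (\<chi> j. \<Sum>i\<in>UNIV. x2 u v $ j $ i * y1 u v $ i)"

definition beta_coeff ::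
  "(real \<Rightarrow> real \<Rightarrow> real ^ 'd) \<Rightarrow> (real \<Rightarrow> real \<Rightarrow> real ^ 'd ^ 'd) \<Rightarrow> real \<Rightarrow> real \<Rightarrow> real ^ 'd" where
  "beta_coeff x1 y2 u v = (\<chi> j. \<Sum>i\<in>UNIV. x1 u v $ i * y2 u v $ j $ i)"

definition gamma_coeff ::
  "(real \<Rightarrow> real \<Rightarrow> real ^ 'd) \<Rightarrow> (real \<Rightarrow> real \<Rightarrow> real ^ 'd ^ 'd) \<Rightarrow>
   (real \<Rightarrow> real \<Rightarrow> real ^ 'd) \<Rightarrow> (real \<Rightarrow> real \<Rightarrow> real ^ 'd ^ 'd) \<Rightarrow> real \<Rightarrow> real \<Rightarrow> real" where
  "gamma_coeff x1 x2 y1 y2 u v =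
     (\<Sum>i\<in>UNIV. x1 u v $ i * y1 u v $ i) +
     (\<Sum>i\<in>UNIV. \<Sum>j\<in>UNIV. x2 u v $ i $ j * y2 u v $ i $ j)"

definition block_1 :: "'d state \<Rightarrow> real" where
  "block_1 z = fst z"

definition block_2 :: "'d state \<Rightarrow> real ^ 'd" where
  "block_2 z = fst (snd z)"

definition block_3 :: "'d state \<Rightarrow> real ^ 'd" where
  "block_3 z = snd (snd z)"

text \<open>
  For piecewise constant coefficients and \<open>h\<close> continuous on the square, all the integrands
  below are integrable, so the default value of \<open>integral\<close> never enters.
\<close>

definition integral_op ::
  "(real \<Rightarrow> real \<Rightarrow> real) \<Rightarrow> (real \<Rightarrow> real \<Rightarrow> real ^ 'd) \<Rightarrow> (real \<Rightarrow> real \<Rightarrow> real ^ 'd) \<Rightarrow>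
   (real \<Rightarrow> real \<Rightarrow> real ^ 'd) \<Rightarrow> (real \<Rightarrow> real \<Rightarrow> real ^ 'd ^ 'd) \<Rightarrow>
   (real \<Rightarrow> real \<Rightarrow> real ^ 'd) \<Rightarrow> (real \<Rightarrow> real \<Rightarrow> real ^ 'd ^ 'd) \<Rightarrow>
   (real \<times> real \<Rightarrow> 'd state) \<Rightarrow> real \<times> real \<Rightarrow> 'd state" where
  "integral_op \<gamma> \<alpha> \<beta> x1 x2 y1 y2 h = (\<lambda>(s, t).
     (integral {0..s} (\<lambda>u. integral {0..t} (\<lambda>v.
        \<gamma> u v * block_1 (h (u, v)) + \<alpha> u v \<bullet> block_2 (h (u, v)) + \<beta> u v \<bullet> block_3 (h (u, v)))),
      integral {0..t} (\<lambda>v.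
        block_1 (h (s, v)) *\<^sub>R y1 s v + transpose (y2 s v) *v block_3 (h (s, v))),
      integral {0..s} (\<lambda>u.
        block_1 (h (u, t)) *\<^sub>R x1 u t + transpose (x2 u t) *v block_2 (h (u, t)))))"

end

theory Submission
  imports Defs
begin

text \<open>
  The sup norm weighted by \<open>exp (L * (s + t))\<close> turns \<open>id - \<T>\<close> into a perturbation of the identity:
  each integration costs a factor \<open>1 / L\<close>, also in the last two blocks where only one variable is
  integrated, so \<open>\<T>\<close> is a contraction for large \<open>L\<close>. That \<open>\<T>\<close> preserves continuity uses
  that the coefficients multiplying the single integrals depend on the variable of integration only.
\<close>

text \<open>The coefficient bounds may be large, so the plain sup norm need not give a contraction.
  The weight is a product of \<open>exp (L * s)\<close> and \<open>exp (L * t)\<close>, so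
  integrating in either variable reproduces it with the factor \<open>1 / L\<close> while the other
  variable merely rides along. The obstacle is that the coefficients jump, hence the integrands are
  not continuous. In a single integral, a jump in the variable that is not integrated would survive
  in the result. In the double integral the coefficients depend on both variables, but each upper
  limit smooths one of them: the inner integral is Lipschitz in its upper limit, uniformly in the
  outer variable, and the outer integration absorbs the remaining jumps. The weighted norm appears
  only through inequalities \<open>norm (h z) \<le> N * w z\<close> on the square. Of the
  coefficients, the argument retains linearity in the state, the step structure and one common bound
  \<open>K\<close>.\<close>

section \<open>Fixed points of contractions in a weighted sup norm\<close>

text \<open>The \<open>N\<close> found here is the weighted sup norm, the maximum of
  \<open>norm (f z) / w z\<close>. The bound serves existence; that it is attained serves
  uniqueness.\<close>

lemma weighted_bound_on_compact:
  fixes f :: "'a::topological_space \<Rightarrow> 'b::real_normed_vector" and w :: "'a \<Rightarrow> real"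
  assumes "compact S" "continuous_on S f" "continuous_on S w" and pos: "\<And>z. z \<in> S \<Longrightarrow> 0 < w z"
  shows "\<exists>N. (\<forall>z\<in>S. norm (f z) \<le> N * w z) \<and> (S \<noteq> {} \<longrightarrow> (\<exists>z\<in>S. norm (f z) = N * w z))"
proof (cases "S = {}")
  case False
  have "\<forall>z\<in>S. w z \<noteq> 0" using pos by force
  then have "continuous_on S (\<lambda>z. norm (f z) / w z)"
    using assms by (intro continuous_intros) auto
  from continuous_attains_sup[OF \<open>compact S\<close> False this]
  obtain z0 where z0: "z0 \<in> S" "\<And>z. z \<in> S \<Longrightarrow> norm (f z) / w z \<le> norm (f z0) / w z0"
    by blast
  show ?thesis
  proof (intro exI conjI impI ballI)
    show "norm (f z) \<le> norm (f z0) / w z0 * w z" if "z \<in> S" for z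
      using z0(2)[OF that] pos[OF that] by (simp only: pos_divide_le_eq)
    show "\<exists>z\<in>S. norm (f z) = norm (f z0) / w z0 * w z"
      using z0(1) pos[OF z0(1)] by (intro bexI[of _ z0]) auto
  qed
qed auto

text \<open>Banach's fixed point theorem with the metric unfolded: the Picard iterates
  \<open>H n\<close> differ by at most \<open>c ^ n * N * w z\<close>, and their telescoping series
  converges uniformly. The map \<open>T\<close> acts on total functions; \<open>contr\<close> with
  \<open>N = 0\<close> makes its values on \<open>S\<close> depend only on the restriction of the
  argument to \<open>S\<close>.\<close>

lemma weighted_contraction_ex1:
  fixes T :: "('a::topological_space \<Rightarrow> 'b::banach) \<Rightarrow> 'a \<Rightarrow> 'b" and w :: "'a \<Rightarrow> real"
  assumes S: "compact S" "continuous_on S w" and pos: "\<And>z. z \<in> S \<Longrightarrow> 0 < w z"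
    and c: "0 \<le> c" "c < 1" and g: "continuous_on S g"
    and cont: "\<And>h. continuous_on S h \<Longrightarrow> continuous_on S (T h)"
    and contr: "\<And>h k N z. continuous_on S h \<Longrightarrow> continuous_on S k \<Longrightarrow>
      (\<And>z. z \<in> S \<Longrightarrow> norm (h z - k z) \<le> N * w z) \<Longrightarrow> z \<in> S \<Longrightarrow>
      norm (T h z - T k z) \<le> c * N * w z"
  shows "\<exists>!\<Phi>. \<Phi> \<in> extensional S \<and> continuous_on S \<Phi> \<and> (\<forall>z\<in>S. \<Phi> z - T \<Phi> z = g z)"
proof (rule ex_ex1I)
  define H where "H n = ((\<lambda>h z. g z + T h z) ^^ n) g" for n
  have H_Suc: "H (Suc n) z = g z + T (H n) z" for n z
    by (simp add: H_def)
  have H_cont: "continuous_on S (H n)" for n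
  proof (induction n)
    case (Suc n)
    then show ?case
      unfolding H_Suc by (intro continuous_intros g cont)
  qed (simp add: H_def g)
  obtain N where N: "\<And>z. z \<in> S \<Longrightarrow> norm (H 1 z - H 0 z) \<le> N * w z"
    using weighted_bound_on_compact[OF S(1) continuous_on_diff[OF H_cont[of 1] H_cont[of 0]] S(2) pos] by blast
  have step: "norm (H (Suc n) z - H n z) \<le> c ^ n * N * w z" if "z \<in> S" for n z
    using that
  proof (induction n arbitrary: z)
    case (Suc n)
    have "norm (T (H (Suc n)) z - T (H n) z) \<le> c * (c ^ n * N) * w z"
      using Suc.prems by (intro contr H_cont Suc.IH) auto
    then show ?case
      by (simp add: H_Suc mult.assoc)
  qed (use N in simp)
  \<comment> \<open>\<open>W\<close> bounds the weight and \<open>V\<close> bounds its reciprocal,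
    so weighted and plain uniform estimates can be exchanged in both directions.\<close>
  obtain W where W: "\<And>z. z \<in> S \<Longrightarrow> norm (w z) \<le> W * 1"
    using weighted_bound_on_compact[OF S continuous_on_const zero_less_one] by blast
  obtain V where V: "\<And>z. z \<in> S \<Longrightarrow> norm (1::real) \<le> V * w z"
    using weighted_bound_on_compact[OF S(1) continuous_on_const S(2) pos] by blast
  define \<Phi> where "\<Phi> z = H 0 z + (\<Sum>n. H (Suc n) z - H n z)" for z
  have "uniform_limit S (\<lambda>n z. \<Sum>i<n. H (Suc i) z - H i z)
          (\<lambda>z. \<Sum>i. H (Suc i) z - H i z) sequentially"
  proof (rule Weierstrass_m_test)
    show "norm (H (Suc n) z - H n z) \<le> c ^ n * (\<bar>N\<bar> * W)" if "z \<in> S" for n z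
    proof -
      have "norm (H (Suc n) z - H n z) \<le> c ^ n * (N * w z)"
        using step[OF that] by (simp add: mult.assoc)
      also have "\<dots> \<le> c ^ n * (\<bar>N\<bar> * W)"
        using W[OF that] pos[OF that] c by (intro mult_left_mono mult_mono) auto
      finally show ?thesis .
    qed
    show "summable (\<lambda>n. c ^ n * (\<bar>N\<bar> * W))"
      using c by (intro summable_mult2 summable_geometric) auto
  qed
  then have "uniform_limit S (\<lambda>n z. H n z - H 0 z) (\<lambda>z. \<Sum>i. H (Suc i) z - H i z) sequentially"
    by (simp only: sum_lessThan_telescope[of "\<lambda>n. H n z" for z])
  from uniform_limit_add[OF uniform_limit_const[where c = "H 0"] this]
  have lim: "uniform_limit S H \<Phi> sequentially"
    by (simp add: \<Phi>_def[abs_def])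
  have \<Phi>_cont: "continuous_on S \<Phi>"
    using uniform_limit_theorem[OF _ lim] H_cont by simp
  have fix_eq: "\<Phi> z = g z + T \<Phi> z" if z: "z \<in> S" for z
  proof -
    have "(\<lambda>n. T (H n) z) \<longlonglongrightarrow> T \<Phi> z"
    proof (rule tendstoI)
      fix e :: real assume "e > 0"
      have "0 < V * w z" using V[OF z] by simp
      then have "V > 0" using pos[OF z] by (simp add: zero_less_mult_iff)
      \<comment> \<open>Chosen so that \<open>d * V * w z = e\<close>: a plain error
        \<open>d\<close> in the iterate is a weighted error \<open>d * V\<close>, which
        \<open>T\<close> turns into at most \<open>c * e\<close> at \<open>z\<close>.\<close>
      define d where "d = e / w z / V"
      have "d > 0" using \<open>e > 0\<close> \<open>V > 0\<close> pos[OF z] by (simp add: d_def)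
      have "\<forall>\<^sub>F n in sequentially. \<forall>y\<in>S. dist (H n y) (\<Phi> y) < d"
        using uniform_limitD[OF lim \<open>d > 0\<close>] .
      then show "\<forall>\<^sub>F n in sequentially. dist (T (H n) z) (T \<Phi> z) < e"
      proof eventually_elim
        case (elim n)
        have "norm (H n y - \<Phi> y) \<le> d * V * w y" if "y \<in> S" for y
        proof -
          have "norm (H n y - \<Phi> y) \<le> d * 1" using elim that by (simp add: dist_norm less_imp_le)
          also have "\<dots> \<le> d * (V * w y)" using V[OF that] \<open>d > 0\<close> by (intro mult_left_mono) auto
          finally show ?thesis by (simp add: mult.assoc)
        qed
        from contr[OF H_cont \<Phi>_cont this z]
        have "norm (T (H n) z - T \<Phi> z) \<le> c * (d * V) * w z" .
        also have "\<dots> = c * e" using \<open>V > 0\<close> pos[OF z] by (simp add: d_def)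
        also have "\<dots> < e" using c \<open>e > 0\<close> by simp
        finally show ?case by (simp add: dist_norm)
      qed
    qed
    then have "(\<lambda>n. H (Suc n) z) \<longlonglongrightarrow> g z + T \<Phi> z"
      unfolding H_Suc by (intro tendsto_intros)
    moreover have "(\<lambda>n. H (Suc n) z) \<longlonglongrightarrow> \<Phi> z"
      using tendsto_uniform_limitI[OF lim z] by (rule LIMSEQ_Suc)
    ultimately show ?thesis by (rule LIMSEQ_unique[symmetric])
  qed
  \<comment> \<open>Restricting to \<open>S\<close> achieves extensionality; the estimate with
    \<open>N = 0\<close> shows that \<open>T\<close> does not notice the change on
    \<open>S\<close>.\<close>
  have "norm (T (restrict \<Phi> S) z - T \<Phi> z) \<le> c * 0 * w z" if "z \<in> S" for z
    by (rule contr) (use that \<Phi>_cont in \<open>auto cong: continuous_on_cong\<close>)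
  then show "\<exists>\<Phi>. \<Phi> \<in> extensional S \<and> continuous_on S \<Phi> \<and> (\<forall>z\<in>S. \<Phi> z - T \<Phi> z = g z)"
    using \<Phi>_cont fix_eq
    by (intro exI[of _ "restrict \<Phi> S"]) (auto cong: continuous_on_cong simp: algebra_simps)
next
  fix \<Phi> \<Psi>
  assume \<Phi>: "\<Phi> \<in> extensional S \<and> continuous_on S \<Phi> \<and> (\<forall>z\<in>S. \<Phi> z - T \<Phi> z = g z)"
    and \<Psi>: "\<Psi> \<in> extensional S \<and> continuous_on S \<Psi> \<and> (\<forall>z\<in>S. \<Psi> z - T \<Psi> z = g z)"
  have "continuous_on S (\<lambda>z. \<Phi> z - \<Psi> z)"
    using \<Phi> \<Psi> by (intro continuous_intros) auto
  from weighted_bound_on_compact[OF S(1) this S(2) pos]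
  obtain N where N: "\<And>z. z \<in> S \<Longrightarrow> norm (\<Phi> z - \<Psi> z) \<le> N * w z"
    and N_eq: "S \<noteq> {} \<Longrightarrow> \<exists>z\<in>S. norm (\<Phi> z - \<Psi> z) = N * w z"
    by blast
  have "\<Phi> z = \<Psi> z" if "z \<in> S" for z
  proof -
    \<comment> \<open>At a point where the weighted distance \<open>N\<close> is attained, the
      contraction gives \<open>N \<le> c * N\<close>, which forces \<open>N \<le> 0\<close>.\<close>
    obtain y where y: "y \<in> S" "norm (\<Phi> y - \<Psi> y) = N * w y" using N_eq \<open>z \<in> S\<close> by auto
    have "\<Phi> y - \<Psi> y = T \<Phi> y - T \<Psi> y"
      using \<Phi> \<Psi> y(1) by (smt (verit, best) add_diff_cancel_left' diff_add_cancel diff_diff_eq2)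
    then have "N * w y \<le> c * N * w y"
      using contr[of \<Phi> \<Psi> N y] N y \<Phi> \<Psi> by auto
    then have "N \<le> c * N"
      using pos[OF y(1)] by (simp only: mult_le_cancel_right_pos)
    then have "(1 - c) * N \<le> 0" by (simp add: algebra_simps)
    then have "N \<le> 0" using c by (simp add: mult_le_0_iff)
    then have "N * w z \<le> 0" using pos[OF that] by (simp add: mult_le_0_iff)
    with N[OF that] have "norm (\<Phi> z - \<Psi> z) \<le> 0" by linarith
    then show ?thesis by simp
  qed
  then show "\<Phi> = \<Psi>" using \<Phi> \<Psi> by (intro extensionalityI[of _ S]) auto
qed

section \<open>Integration of piecewise continuous functions and parametric primitives\<close>

lemma partition01_bounds:
  assumes p: "partition01 m p" and "i < m"
  shows "0 \<le> p i" "p (Suc i) \<le> 1"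
proof -
  have mono: "p k \<le> p j" if "k \<le> j" "j \<le> m" for k j
    using that
  proof (induction j rule: dec_induct)
    case (step j)
    have "p j < p (Suc j)" using p step.prems by (auto simp: partition01_def)
    then show ?case using step by simp
  qed simp
  show "0 \<le> p i" "p (Suc i) \<le> 1"
    using mono[of 0 i] mono[of "Suc i" m] assms by (auto simp: partition01_def)
qed

text \<open>Only the open intervals are constrained, since the values at partition points are
  arbitrary. On each closed piece \<open>f\<close> differs from a continuous function at the two
  endpoints at most, and the pieces are joined by induction.\<close>

lemma piecewise_continuous_integrable:
  fixes f :: "real \<Rightarrow> 'a::banach"
  assumes p: "partition01 m p"
    and f: "\<And>i. i < m \<Longrightarrow> \<exists>g. continuous_on {0..1} g \<and> (\<forall>r\<in>{p i<..<p (Suc i)}. f r = g r)"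
  shows "f integrable_on {0..1}"
proof -
  have "f integrable_on {0..p i}" if "i \<le> m" for i
    using that
  proof (induction i)
    case 0
    then show ?case using p integrable_on_refl[of f 0] by (simp add: partition01_def)
  next
    case (Suc i)
    obtain g where g: "continuous_on {0..1} g" "\<forall>r\<in>{p i<..<p (Suc i)}. f r = g r"
      using f[of i] Suc.prems by auto
    have le: "0 \<le> p i" "p i \<le> p (Suc i)" "p (Suc i) \<le> 1"
      using partition01_bounds[OF p, of i] Suc.prems p
      by (auto simp: partition01_def Suc_le_eq less_imp_le)
    have "g integrable_on {p i..p (Suc i)}"
      using le by (intro integrable_continuous_real continuous_on_subset[OF g(1)]) auto
    then have "f integrable_on {p i..p (Suc i)}"
      by (rule integrable_spike_finite[of "{p i, p (Suc i)}", rotated 2]) (use g(2) in auto)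
    with Suc le show ?case
      by (auto intro: Henstock_Kurzweil_Integration.integrable_combine[of 0 "p i" "p (Suc i)"])
  qed
  from this[of m] show ?thesis using p by (simp add: partition01_def)
qed

lemma norm_integral_le_const:
  fixes f :: "real \<Rightarrow> 'a::banach"
  assumes "f integrable_on {a..b}" "a \<le> b" "0 \<le> B" "\<And>x. x \<in> {a..b} \<Longrightarrow> norm (f x) \<le> B"
  shows "norm (integral {a..b} f) \<le> B * (b - a)"
  using has_integral_bound_real[OF assms(3) finite.emptyI integrable_integral[OF assms(1)]] assms
  by simp

lemma primitive_lipschitz:
  fixes f :: "real \<Rightarrow> 'a::banach"
  assumes int: "f integrable_on {0..1}" and bound: "\<And>u. u \<in> {0..1} \<Longrightarrow> norm (f u) \<le> B"
    and "s \<in> {0..1}" "s' \<in> {0..1}"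
  shows "norm (integral {0..s} f - integral {0..s'} f) \<le> B * \<bar>s - s'\<bar>"
proof -
  have B: "B \<ge> 0" using order_trans[OF norm_ge_zero bound[of 0]] by simp
  have sub: "f integrable_on {a..b}" if "{a..b} \<subseteq> {0..1}" for a b
    using integrable_subinterval_real[OF int that] .
  have *: "norm (integral {0..r} f - integral {0..r'} f) \<le> B * \<bar>r - r'\<bar>"
    if "r \<in> {0..1}" "r' \<in> {0..1}" "r \<le> r'" for r r'
  proof -
    have "integral {0..r} f + integral {r..r'} f = integral {0..r'} f"
      using that by (intro Henstock_Kurzweil_Integration.integral_combine sub) auto
    moreover have "norm (integral {r..r'} f) \<le> B * (r' - r)"
      using that B by (intro norm_integral_le_const sub bound) auto
    ultimately show ?thesis using that
      by (metis abs_minus_commute abs_of_nonneg add_diff_cancel_left' diff_ge_0_iff_ge norm_minus_commute)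
  qed
  show ?thesis
    using *[of s s'] *[of s' s] assms(3,4) by (metis abs_minus_commute linear norm_minus_commute)
qed

text \<open>Continuity of \<open>F\<close> in \<open>u\<close> is not assumed, as the integrands
  jump there. Moving \<open>s\<close> costs at most \<open>B\<close> times the displacement; moving
  \<open>t\<close> is controlled by a modulus uniform in \<open>u\<close>.\<close>

lemma continuous_on_parametric_primitive:
  fixes F :: "real \<Rightarrow> real \<Rightarrow> 'a::banach"
  assumes int: "\<And>t. t \<in> {0..1} \<Longrightarrow> (\<lambda>u. F u t) integrable_on {0..1}"
    and bound: "\<And>u t. u \<in> {0..1} \<Longrightarrow> t \<in> {0..1} \<Longrightarrow> norm (F u t) \<le> B"
    and unif: "\<And>e. e > 0 \<Longrightarrow> \<exists>d>0. \<forall>u\<in>{0..1}. \<forall>t\<in>{0..1}. \<forall>t'\<in>{0..1}.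
      dist t t' < d \<longrightarrow> norm (F u t - F u t') \<le> e"
  shows "continuous_on unit_square (\<lambda>(s, t). integral {0..s} (\<lambda>u. F u t))"
proof (rule continuous_onI)
  have B: "B \<ge> 0" using order_trans[OF norm_ge_zero bound[of 0 0]] by simp
  have sub: "(\<lambda>u. F u t) integrable_on {a..b}" if "t \<in> {0..1}" "{a..b} \<subseteq> {0..1}" for t a b
    using integrable_subinterval_real[OF int[OF that(1)] that(2)] .
  have incr: "norm (integral {0..s} (\<lambda>u. F u t) - integral {0..s'} (\<lambda>u. F u t)) \<le> B * \<bar>s - s'\<bar>"
    if "t \<in> {0..1}" "s \<in> {0..1}" "s' \<in> {0..1}" for s s' t
    using that bound by (intro primitive_lipschitz int) auto
  fix z :: "real \<times> real" and e :: real
  assume z: "z \<in> unit_square" and "e > 0"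
  obtain d where d: "d > 0" "\<forall>u\<in>{0..1}. \<forall>t\<in>{0..1}. \<forall>t'\<in>{0..1}.
      dist t t' < d \<longrightarrow> norm (F u t - F u t') \<le> e / 3"
    using unif[of "e / 3"] \<open>e > 0\<close> by auto
  \<comment> \<open>The second entry makes the change in \<open>s\<close> cost at most
    \<open>e / 3\<close>; the summand 1 guards against \<open>B = 0\<close>.\<close>
  define \<delta> where "\<delta> = min d (e / (3 * (B + 1)))"
  have "\<delta> > 0" using d B \<open>e > 0\<close> by (simp add: \<delta>_def)
  have "dist (case y of (s, t) \<Rightarrow> integral {0..s} (\<lambda>u. F u t))
             (case z of (s, t) \<Rightarrow> integral {0..s} (\<lambda>u. F u t)) \<le> e"
    if y: "y \<in> unit_square" "dist y z < \<delta>" for y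
  proof -
    obtain s t s' t' where [simp]: "z = (s, t)" "y = (s', t')" by (cases z, cases y)
    have mem: "s \<in> {0..1}" "t \<in> {0..1}" "s' \<in> {0..1}" "t' \<in> {0..1}" using z y(1) by auto
    have "\<bar>s' - s\<bar> \<le> \<delta>" "dist t' t < \<delta>"
      using dist_fst_le[of y z] dist_snd_le[of y z] y(2) by (auto simp: dist_real_def)
    then have "dist t' t < d" by (simp add: \<delta>_def)
    have "norm (integral {0..s'} (\<lambda>u. F u t' - F u t)) \<le> e / 3 * (s' - 0)"
      using mem d(2) \<open>dist t' t < d\<close> \<open>e > 0\<close> by (intro norm_integral_le_const integrable_diff sub) auto
    also have "\<dots> \<le> e / 3 * 1" using mem \<open>e > 0\<close> by (intro mult_left_mono) auto
    also have "integral {0..s'} (\<lambda>u. F u t' - F u t)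
        = integral {0..s'} (\<lambda>u. F u t') - integral {0..s'} (\<lambda>u. F u t)"
      using mem by (intro integral_diff sub) auto
    finally have 1: "norm (integral {0..s'} (\<lambda>u. F u t') - integral {0..s'} (\<lambda>u. F u t)) \<le> e / 3"
      by simp
    have "B * \<bar>s' - s\<bar> \<le> B * (e / (3 * (B + 1)))"
      using \<open>\<bar>s' - s\<bar> \<le> \<delta>\<close> B by (intro mult_left_mono) (auto simp: \<delta>_def)
    also have "\<dots> \<le> e / 3" using B \<open>e > 0\<close> by (simp add: field_simps)
    finally have 2: "norm (integral {0..s'} (\<lambda>u. F u t) - integral {0..s} (\<lambda>u. F u t)) \<le> e / 3"
      using incr[of t s' s] mem by simp
    show ?thesis
      using norm_diff_triangle_le[OF 1 2] \<open>e > 0\<close> by (simp add: dist_norm)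
  qed
  then show "\<exists>d>0. \<forall>y\<in>unit_square. dist y z < d \<longrightarrow>
      dist (case y of (s, t) \<Rightarrow> integral {0..s} (\<lambda>u. F u t))
           (case z of (s, t) \<Rightarrow> integral {0..s} (\<lambda>u. F u t)) \<le> e"
    using \<open>\<delta> > 0\<close> by blast
qed

text \<open>The source of the gain \<open>1 / L\<close>: the exponential is integrated exactly and
  the nonnegative term from the lower limit is dropped. Here \<open>t\<close> is a passive
  parameter, standing for whichever variable is frozen.\<close>

lemma norm_integral_le_exp:
  fixes f :: "real \<Rightarrow> 'a::banach"
  assumes "f integrable_on {0..s}" "0 \<le> s" "0 < L" "0 \<le> C"
    and "\<And>u. u \<in> {0..s} \<Longrightarrow> norm (f u) \<le> C * exp (L * (u + t))"
  shows "norm (integral {0..s} f) \<le> C / L * exp (L * (s + t))"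
proof -
  have "((\<lambda>u. C * exp (L * (u + t))) has_integral
      C / L * exp (L * (s + t)) - C / L * exp (L * (0 + t))) {0..s}"
    using assms(2,3)
    by (intro fundamental_theorem_of_calculus)
       (auto intro!: derivative_eq_intros simp flip: has_real_derivative_iff_has_vector_derivative)
  then have "norm (integral {0..s} f) \<le> C / L * exp (L * (s + t)) - C / L * exp (L * (0 + t))"
    using integral_norm_bound_integral[OF assms(1) _ assms(5)] by (simp add: has_integral_iff)
  also have "\<dots> \<le> C / L * exp (L * (s + t))" using assms by simp
  finally show ?thesis .
qed

section \<open>One-variable integral operators with step kernels\<close>

lemma step_kernel_integrable:
  fixes A :: "real \<Rightarrow> 's::real_normed_vector \<Rightarrow> 'a::banach"
  assumes p: "partition01 m p" and step: "\<And>i. i < m \<Longrightarrow> A constant_on {p i<..<p (Suc i)}"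
    and lin: "\<And>u. bounded_linear (A u)" and g: "continuous_on {0..1} g"
  shows "(\<lambda>u. A u (g u)) integrable_on {0..1}"
proof (rule piecewise_continuous_integrable[OF p])
  fix i assume i: "i < m"
  define c where "c = (p i + p (Suc i)) / 2"
  have "c \<in> {p i<..<p (Suc i)}" using p i by (auto simp: c_def partition01_def)
  then have "\<forall>r\<in>{p i<..<p (Suc i)}. A r = A c"
    using step[OF i] unfolding constant_on_def by metis
  then show "\<exists>f. continuous_on {0..1} f \<and> (\<forall>r\<in>{p i<..<p (Suc i)}. A r (g r) = f r)"
    using bounded_linear.continuous_on[OF lin g] by (intro exI[of _ "\<lambda>r. A c (g r)"]) auto
qed

lemma continuous_on_slices:
  assumes "continuous_on unit_square h"
  shows "t \<in> {0..1} \<Longrightarrow> continuous_on {0..1} (\<lambda>u. h (u, t))"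
    and "s \<in> {0..1} \<Longrightarrow> continuous_on {0..1} (\<lambda>v. h (s, v))"
  by (auto intro!: continuous_on_compose2[OF assms] continuous_intros)

lemma unit_square_bound:
  fixes h :: "real \<times> real \<Rightarrow> 's::real_normed_vector"
  assumes "continuous_on unit_square h"
  obtains B where "0 \<le> B" "\<And>z. z \<in> unit_square \<Longrightarrow> norm (h z) \<le> B"
proof -
  have "compact (h ` unit_square)"
    by (intro compact_continuous_image assms compact_Times) auto
  from bounded_pos[THEN iffD1, OF compact_imp_bounded[OF this]] show thesis
    using that by (auto intro: less_imp_le)
qed

text \<open>As \<open>A u\<close> does not involve \<open>t\<close>, the difference of integrands at
  \<open>t\<close> and \<open>t'\<close> is at most \<open>K\<close> times that of \<open>h\<close>.
  Uniform continuity of \<open>h\<close> on the compact square then gives a modulus independent of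
  \<open>u\<close>, despite the jumps of \<open>A\<close>.\<close>

lemma step_kernel_continuous:
  fixes A :: "real \<Rightarrow> 's::real_normed_vector \<Rightarrow> 'a::banach"
  assumes p: "partition01 m p" and step: "\<And>i. i < m \<Longrightarrow> A constant_on {p i<..<p (Suc i)}"
    and lin: "\<And>u. bounded_linear (A u)"
    and K: "0 \<le> K" "\<And>u z. u \<in> {0..1} \<Longrightarrow> norm (A u z) \<le> K * norm z"
    and h: "continuous_on unit_square h"
  shows "continuous_on unit_square (\<lambda>(s, t). integral {0..s} (\<lambda>u. A u (h (u, t))))"
proof -
  obtain B where B: "0 \<le> B" "\<And>z. z \<in> unit_square \<Longrightarrow> norm (h z) \<le> B"
    using unit_square_bound[OF h] by blast
  show ?thesis
  proof (rule continuous_on_parametric_primitive)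
    show "(\<lambda>u. A u (h (u, t))) integrable_on {0..1}" if "t \<in> {0..1}" for t
      by (intro step_kernel_integrable[OF p step lin] continuous_on_slices[OF h] that)
    show "norm (A u (h (u, t))) \<le> K * B" if "u \<in> {0..1}" "t \<in> {0..1}" for u t
      using that by (intro order_trans[OF K(2)] mult_left_mono K B) auto
    fix e :: real assume "e > 0"
    have "uniformly_continuous_on unit_square h"
      by (intro compact_uniformly_continuous h compact_Times) auto
    moreover have "e / (K + 1) > 0" using \<open>e > 0\<close> K(1) by simp
    ultimately obtain d where d: "d > 0" "\<forall>x\<in>unit_square. \<forall>x'\<in>unit_square.
        dist x' x < d \<longrightarrow> dist (h x') (h x) < e / (K + 1)"
      unfolding uniformly_continuous_on_def by meson
    have "norm (A u (h (u, t)) - A u (h (u, t'))) \<le> e"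
      if "u \<in> {0..1}" "t \<in> {0..1}" "t' \<in> {0..1}" "dist t t' < d" for u t t'
    proof -
      have "dist (u, t) (u, t') < d" using that(4) by (simp add: dist_Pair_Pair)
      then have "norm (h (u, t) - h (u, t')) \<le> e / (K + 1)"
        using d(2) that by (simp add: dist_norm less_imp_le)
      then have "norm (A u (h (u, t) - h (u, t'))) \<le> K * (e / (K + 1))"
        by (intro order_trans[OF K(2)] mult_left_mono K(1) that)
      also have "\<dots> \<le> e" using K(1) \<open>e > 0\<close> by (simp add: field_simps)
      finally show ?thesis using linear_diff[OF bounded_linear.linear[OF lin]] by metis
    qed
    then show "\<exists>d>0. \<forall>u\<in>{0..1}. \<forall>t\<in>{0..1}. \<forall>t'\<in>{0..1}.
        dist t t' < d \<longrightarrow> norm (A u (h (u, t)) - A u (h (u, t'))) \<le> e"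
      using d(1) by blast
  qed
qed

lemma continuous_on_unit_square_swap:
  assumes "continuous_on unit_square h"
  shows "continuous_on unit_square (\<lambda>(s, t). h (t, s))"
  unfolding split_beta by (auto intro!: continuous_on_compose2[OF assms] continuous_intros)

lemma step_kernel_exp_bound:
  fixes A :: "real \<Rightarrow> 's::real_normed_vector \<Rightarrow> 'a::banach"
  assumes p: "partition01 m p" and step: "\<And>i. i < m \<Longrightarrow> A constant_on {p i<..<p (Suc i)}"
    and lin: "\<And>u. bounded_linear (A u)"
    and K: "0 \<le> K" "\<And>u z. u \<in> {0..1} \<Longrightarrow> norm (A u z) \<le> K * norm z"
    and g: "continuous_on {0..1} g" "continuous_on {0..1} g'" and "0 < L" "0 \<le> N"
    and diff: "\<And>u. u \<in> {0..1} \<Longrightarrow> norm (g u - g' u) \<le> N * exp (L * (u + t))"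
    and s: "s \<in> {0..1}"
  shows "norm (integral {0..s} (\<lambda>u. A u (g u)) - integral {0..s} (\<lambda>u. A u (g' u)))
      \<le> K * N / L * exp (L * (s + t))"
proof -
  have sub: "(\<lambda>u. A u (f u)) integrable_on {0..s}" if "continuous_on {0..1} f" for f
    using integrable_subinterval_real[OF step_kernel_integrable[OF p step lin that], of 0 s] s by auto
  have "norm (integral {0..s} (\<lambda>u. A u (g u - g' u))) \<le> K * N / L * exp (L * (s + t))"
  proof (rule norm_integral_le_exp)
    fix u assume "u \<in> {0..s}"
    then show "norm (A u (g u - g' u)) \<le> K * N * exp (L * (u + t))"
      using K(2)[of u "g u - g' u"] mult_left_mono[OF diff[of u] K(1)] s by (simp add: mult.assoc)
  qed (use assms in \<open>auto intro!: sub continuous_intros\<close>)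
  then show ?thesis
    using integral_diff[OF sub[OF g(1)] sub[OF g(2)]]
    by (simp add: linear_diff[OF bounded_linear.linear[OF lin]])
qed

section \<open>Well-posedness of the abstract integrated system\<close>

text \<open>A Goursat problem: a hyperbolic system with data on the characteristics
  \<open>s = 0\<close> and \<open>t = 0\<close>, in integrated form. Each kernel acts on the whole
  state. The first part of \<open>G_step\<close> equates functions of \<open>v\<close>, so with the
  second part \<open>G\<close> is constant on every open rectangle of the grid.\<close>

locale goursat_system =
  fixes m n :: nat and p q :: "nat \<Rightarrow> real" and K :: real
    and G :: "real \<Rightarrow> real \<Rightarrow> 'a::banach \<times> 'b::banach \<times> 'c::banach \<Rightarrow> 'a"
    and Y :: "real \<Rightarrow> 'a \<times> 'b \<times> 'c \<Rightarrow> 'b"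
    and X :: "real \<Rightarrow> 'a \<times> 'b \<times> 'c \<Rightarrow> 'c"
  assumes p: "partition01 m p" and q: "partition01 n q" and K_nonneg: "0 \<le> K"
    and lin: "\<And>u v. bounded_linear (G u v)" "\<And>v. bounded_linear (Y v)" "\<And>u. bounded_linear (X u)"
    and G_step: "\<And>i. i < m \<Longrightarrow> G constant_on {p i<..<p (Suc i)}"
      "\<And>u j. j < n \<Longrightarrow> G u constant_on {q j<..<q (Suc j)}"
    and Y_step: "\<And>j. j < n \<Longrightarrow> Y constant_on {q j<..<q (Suc j)}"
    and X_step: "\<And>i. i < m \<Longrightarrow> X constant_on {p i<..<p (Suc i)}"
    and G_bound: "\<And>u v z. u \<in> {0..1} \<Longrightarrow> v \<in> {0..1} \<Longrightarrow> norm (G u v z) \<le> K * norm z"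
    and Y_bound: "\<And>v z. v \<in> {0..1} \<Longrightarrow> norm (Y v z) \<le> K * norm z"
    and X_bound: "\<And>u z. u \<in> {0..1} \<Longrightarrow> norm (X u z) \<le> K * norm z"
begin

definition goursat_op :: "(real \<times> real \<Rightarrow> 'a \<times> 'b \<times> 'c) \<Rightarrow> real \<times> real \<Rightarrow> 'a \<times> 'b \<times> 'c" where
  "goursat_op h = (\<lambda>(s, t). (integral {0..s} (\<lambda>u. integral {0..t} (\<lambda>v. G u v (h (u, v)))),
      integral {0..t} (\<lambda>v. Y v (h (s, v))), integral {0..s} (\<lambda>u. X u (h (u, t)))))"

text \<open>The inner integral may jump in \<open>u\<close> at partition points. Between two of them
  \<open>G\<close> can be frozen at the midpoint \<open>c\<close>, and what remains depends on
  \<open>u\<close> through \<open>h\<close> alone, hence continuously.\<close>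

lemma inner_integrable:
  assumes h: "continuous_on unit_square h" and t: "t \<in> {0..1}"
  shows "(\<lambda>u. integral {0..t} (\<lambda>v. G u v (h (u, v)))) integrable_on {0..1}"
proof (rule piecewise_continuous_integrable[OF p])
  fix i assume i: "i < m"
  define c where "c = (p i + p (Suc i)) / 2"
  have c: "c \<in> {p i<..<p (Suc i)}" using p i by (auto simp: c_def partition01_def)
  have G_eq: "\<forall>r\<in>{p i<..<p (Suc i)}. G r = G c"
    using G_step(1)[OF i] c unfolding constant_on_def by metis
  have "0 \<le> p i" "p (Suc i) \<le> 1"
    using partition01_bounds[OF p] i by auto
  then have "c \<in> {0..1}" using c by auto
  then have "continuous_on unit_square (\<lambda>(r, s). integral {0..r} (\<lambda>v. G c v (h (s, v))))"
    using step_kernel_continuous[OF q G_step(2) lin(1) K_nonneg G_bound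
        continuous_on_unit_square_swap[OF h], of c] by simp
  from continuous_on_slices(2)[OF this t]
  show "\<exists>g. continuous_on {0..1} g \<and>
      (\<forall>r\<in>{p i<..<p (Suc i)}. integral {0..t} (\<lambda>v. G r v (h (r, v))) = g r)"
    using G_eq by (intro exI[of _ "\<lambda>r. integral {0..t} (\<lambda>v. G c v (h (r, v)))"]) auto
qed

lemma continuous_on_goursat_op:
  assumes h: "continuous_on unit_square h"
  shows "continuous_on unit_square (goursat_op h)"
proof -
  obtain B where B: "0 \<le> B" "\<And>z. z \<in> unit_square \<Longrightarrow> norm (h z) \<le> B"
    using unit_square_bound[OF h] by blast
  have lipschitz: "norm (integral {0..t} (\<lambda>v. G u v (h (u, v))) - integral {0..t'} (\<lambda>v. G u v (h (u, v))))
      \<le> K * B * \<bar>t - t'\<bar>" if "u \<in> {0..1}" "t \<in> {0..1}" "t' \<in> {0..1}" for u t t'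
  proof (rule primitive_lipschitz)
    show "(\<lambda>v. G u v (h (u, v))) integrable_on {0..1}"
      by (intro step_kernel_integrable[OF q G_step(2) lin(1)] continuous_on_slices[OF h] that)
    show "norm (G u v (h (u, v))) \<le> K * B" if "v \<in> {0..1}" for v
      using \<open>u \<in> {0..1}\<close> that
      by (intro order_trans[OF G_bound] mult_left_mono K_nonneg B) auto
  qed (use that in auto)
  have "continuous_on unit_square
      (\<lambda>(s, t). integral {0..s} (\<lambda>u. integral {0..t} (\<lambda>v. G u v (h (u, v)))))"
  proof (rule continuous_on_parametric_primitive[OF inner_integrable[OF h]])
    show "norm (integral {0..t} (\<lambda>v. G u v (h (u, v)))) \<le> K * B"
      if "u \<in> {0..1}" "t \<in> {0..1}" for u t
    proof -
      have "K * B * \<bar>t\<bar> \<le> K * B * 1"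
        using that K_nonneg B by (intro mult_left_mono) auto
      with lipschitz[of u t 0] that show ?thesis by simp
    qed
    fix e :: real assume "e > 0"
    have KB: "K * B \<ge> 0" using K_nonneg B by simp
    have "norm (integral {0..t} (\<lambda>v. G u v (h (u, v))) - integral {0..t'} (\<lambda>v. G u v (h (u, v)))) \<le> e"
      if "u \<in> {0..1}" "t \<in> {0..1}" "t' \<in> {0..1}" "dist t t' < e / (K * B + 1)" for u t t'
    proof -
      have "K * B * \<bar>t - t'\<bar> \<le> K * B * (e / (K * B + 1))"
        using that(4) KB by (intro mult_left_mono) (auto simp: dist_real_def)
      also have "\<dots> \<le> e" using KB \<open>e > 0\<close> by (simp add: divide_le_eq algebra_simps)
      finally show ?thesis using lipschitz[OF that(1-3)] by linarith
    qed
    moreover have "e / (K * B + 1) > 0" using KB \<open>e > 0\<close> by simp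
    ultimately show "\<exists>d>0. \<forall>u\<in>{0..1}. \<forall>t\<in>{0..1}. \<forall>t'\<in>{0..1}. dist t t' < d \<longrightarrow>
        norm (integral {0..t} (\<lambda>v. G u v (h (u, v))) - integral {0..t'} (\<lambda>v. G u v (h (u, v)))) \<le> e"
      by blast
  qed
  \<comment> \<open>The kernel lemma integrates in the first variable, so the square is reflected
    before it is applied and reflected back afterwards.\<close>
  moreover have "continuous_on unit_square (\<lambda>(s, t). integral {0..t} (\<lambda>v. Y v (h (s, v))))"
    using continuous_on_unit_square_swap[OF step_kernel_continuous[OF q Y_step lin(2) K_nonneg Y_bound
        continuous_on_unit_square_swap[OF h]]] by simp
  moreover have "continuous_on unit_square (\<lambda>(s, t). integral {0..s} (\<lambda>u. X u (h (u, t))))"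
    by (rule step_kernel_continuous[OF p X_step lin(3) K_nonneg X_bound h])
  ultimately show ?thesis
    unfolding goursat_op_def split_beta by (intro continuous_on_Pair)
qed

text \<open>The factor 3 comes from bounding the norm of a triple by the sum of the norms of its
  blocks, each contributing \<open>K * N / L\<close>.\<close>

lemma goursat_op_contraction:
  assumes h: "continuous_on unit_square h" "continuous_on unit_square k" and L: "1 \<le> L"
    and diff: "\<And>z. z \<in> unit_square \<Longrightarrow> norm (h z - k z) \<le> N * exp (L * (fst z + snd z))"
    and z: "z \<in> unit_square"
  shows "norm (goursat_op h z - goursat_op k z) \<le> 3 * K / L * N * exp (L * (fst z + snd z))"
proof -
  obtain s t where [simp]: "z = (s, t)" and st: "s \<in> {0..1}" "t \<in> {0..1}" using z by auto
  have N: "0 \<le> N" using order_trans[OF norm_ge_zero diff[of "(0, 0)"]] by simp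
  have L0: "0 < L" using L by simp
  note sl = continuous_on_slices[OF h(1)] continuous_on_slices[OF h(2)]
  let ?I = "\<lambda>h u. integral {0..t} (\<lambda>v. G u v (h (u, v)))"
  \<comment> \<open>Here \<open>v\<close> is integrated and \<open>u\<close> takes the role of the
    passive parameter.\<close>
  have inner: "norm (?I h u - ?I k u) \<le> K * N / L * exp (L * (u + t))" if u: "u \<in> {0..1}" for u
    using step_kernel_exp_bound[where t = u, OF q G_step(2) lin(1) K_nonneg G_bound[OF u] sl(2,4)[OF u] L0 N _ st(2)]
      diff[of "(u, _)"] u by (simp add: add.commute)
  have sub: "?I h integrable_on {0..s}" "?I k integrable_on {0..s}"
    using integrable_subinterval_real[OF inner_integrable[OF h(1) st(2)], of 0 s]
      integrable_subinterval_real[OF inner_integrable[OF h(2) st(2)], of 0 s] st by auto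
  have "norm (integral {0..s} (\<lambda>u. ?I h u - ?I k u)) \<le> K * N / L / L * exp (L * (s + t))"
    using st inner L0 N K_nonneg by (intro norm_integral_le_exp integrable_diff sub) auto
  \<comment> \<open>The double integral gains \<open>1 / L\<close> twice; since
    \<open>1 \<le> L\<close>, one factor is given up to match the other blocks.\<close>
  also have "\<dots> \<le> K * N / L * exp (L * (s + t))"
    using divide_left_mono[of 1 L "K * N / L"] L L0 N K_nonneg by (intro mult_right_mono) auto
  finally have 1: "norm (integral {0..s} (?I h) - integral {0..s} (?I k)) \<le> K * N / L * exp (L * (s + t))"
    by (simp add: integral_diff[OF sub])
  have 2: "norm (integral {0..t} (\<lambda>v. Y v (h (s, v))) - integral {0..t} (\<lambda>v. Y v (k (s, v))))
      \<le> K * N / L * exp (L * (s + t))"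
    using step_kernel_exp_bound[where t = s, OF q Y_step lin(2) K_nonneg Y_bound sl(2,4)[OF st(1)] L0 N _ st(2)]
      diff[of "(s, _)"] st by (simp add: add.commute)
  have 3: "norm (integral {0..s} (\<lambda>u. X u (h (u, t))) - integral {0..s} (\<lambda>u. X u (k (u, t))))
      \<le> K * N / L * exp (L * (s + t))"
    using step_kernel_exp_bound[where t = t, OF p X_step lin(3) K_nonneg X_bound sl(1,3)[OF st(2)] L0 N _ st(1)]
      diff[of "(_, t)"] st by simp
  have "norm (a, b, c) \<le> norm a + norm b + norm c" for a :: 'a and b :: 'b and c :: 'c
    using norm_Pair_le[of a "(b, c)"] norm_Pair_le[of b c] by linarith
  then have "norm (goursat_op h z - goursat_op k z) \<le>
      norm (integral {0..s} (?I h) - integral {0..s} (?I k)) +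
      norm (integral {0..t} (\<lambda>v. Y v (h (s, v))) - integral {0..t} (\<lambda>v. Y v (k (s, v)))) +
      norm (integral {0..s} (\<lambda>u. X u (h (u, t))) - integral {0..s} (\<lambda>u. X u (k (u, t))))"
    by (simp add: goursat_op_def)
  also have "\<dots> \<le> 3 * (K * N / L * exp (L * (s + t)))"
    using 1 2 3 by linarith
  finally show ?thesis by (simp add: algebra_simps)
qed

theorem ex1_solution:
  assumes "continuous_on unit_square g"
  shows "\<exists>!\<Phi>. \<Phi> \<in> C_square \<and> (\<forall>z\<in>unit_square. \<Phi> z - goursat_op \<Phi> z = g z)"
proof -
  \<comment> \<open>With this choice \<open>3 * K / L\<close> is below one half, and the summand 1
    gives \<open>1 \<le> L\<close> even when \<open>K = 0\<close>.\<close>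
  define L where "L = 6 * K + 1"
  have L: "1 \<le> L" "3 * K / L < 1" using K_nonneg by (auto simp: L_def)
  have "\<exists>!\<Phi>. \<Phi> \<in> extensional unit_square \<and> continuous_on unit_square \<Phi> \<and>
      (\<forall>z\<in>unit_square. \<Phi> z - goursat_op \<Phi> z = g z)"
  proof (rule weighted_contraction_ex1[where w = "\<lambda>z. exp (L * (fst z + snd z))" and c = "3 * K / L"])
    show "compact unit_square" by (intro compact_Times) auto
    show "norm (goursat_op h z - goursat_op k z) \<le> 3 * K / L * N * exp (L * (fst z + snd z))"
      if "continuous_on unit_square h" "continuous_on unit_square k"
        "\<And>z. z \<in> unit_square \<Longrightarrow> norm (h z - k z) \<le> N * exp (L * (fst z + snd z))"
        "z \<in> unit_square" for h k N z
      using goursat_op_contraction[OF that(1,2) L(1) that(3,4)] .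
  qed (use L K_nonneg in \<open>auto intro!: continuous_on_goursat_op assms continuous_intros\<close>)
  then show ?thesis by (simp add: C_square_def conj_assoc)
qed

end

section \<open>The concrete coefficients as an instance of the abstract system\<close>

text \<open>Transposition only flips the sign, so the operator norm bounds for \<open>x2\<close> and
  \<open>y2\<close> control the transposes in the integrals.\<close>

lemma norm_transpose_mult_antisymmetric:
  assumes "antisymmetric_matrix A"
  shows "norm (transpose A *v z) \<le> onorm ((*v) A) * norm z"
proof -
  have "transpose A *v z = - (A *v z)"
    using assms
    by (simp add: antisymmetric_matrix_def vec_eq_iff matrix_vector_mult_def sum_negf)
  then show ?thesis
    using onorm[OF matrix_vector_mul_bounded_linear[of A]] by simp
qed

lemma norm_block_le:
  "norm (block_1 z) \<le> norm z" "norm (block_2 z) \<le> norm z" "norm (block_3 z) \<le> norm z"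
  unfolding block_1_def block_2_def block_3_def
  by (metis norm_fst_le norm_snd_le order_trans prod.collapse)+

lemma bounded_linear_block:
  "bounded_linear block_1" "bounded_linear block_2" "bounded_linear block_3"
  unfolding block_1_def[abs_def] block_2_def[abs_def] block_3_def[abs_def]
  by (rule bounded_linear_fst bounded_linear_compose[OF bounded_linear_fst bounded_linear_snd]
      bounded_linear_compose[OF bounded_linear_snd bounded_linear_snd])+

theorem theorem4p3:
  fixes m n :: nat and p q :: "nat \<Rightarrow> real"
    and x1 y1 :: "real \<Rightarrow> real \<Rightarrow> real ^ 'd::finite"
    and x2 y2 :: "real \<Rightarrow> real \<Rightarrow> real ^ 'd ^ 'd"
    and \<gamma> :: "real \<Rightarrow> real \<Rightarrow> real" and \<alpha> \<beta> :: "real \<Rightarrow> real \<Rightarrow> real ^ 'd"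
    and a b :: "real ^ 'd" and h0 :: "real \<times> real \<Rightarrow> 'd state"
    and M K1 K2 K3 K4 K5 K6 K7 :: real
  assumes "partition01 m p" and "partition01 n q"
    and "step_in_first m p x1" and "step_in_first m p x2"
    and "step_in_second n q y1" and "step_in_second n q y2"
    and "\<forall>s\<in>{0..1}. \<forall>t\<in>{0..1}. antisymmetric_matrix (x2 s t) \<and> antisymmetric_matrix (y2 s t)"
    and "\<alpha> = alpha_coeff x2 y1" and "\<beta> = beta_coeff x1 y2" and "\<gamma> = gamma_coeff x1 x2 y1 y2"
    and "h0 = (\<lambda>_. (1, a, b))"
    and "\<forall>s\<in>{0..1}. \<forall>t\<in>{0..1}.
           norm (h0 (s, t)) \<le> M \<and> \<bar>\<gamma> s t\<bar> \<le> K1 \<and> norm (\<alpha> s t) \<le> K2 \<and> norm (\<beta> s t) \<le> K3 \<and>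
           norm (x1 s t) \<le> K4 \<and> norm (y1 s t) \<le> K5 \<and>
           onorm ((*v) (x2 s t)) \<le> K6 \<and> onorm ((*v) (y2 s t)) \<le> K7"
  shows "\<exists>!\<Phi>. \<Phi> \<in> C_square \<and>
           (\<forall>z\<in>unit_square. \<Phi> z - integral_op \<gamma> \<alpha> \<beta> x1 x2 y1 y2 \<Phi> z = h0 z)"
proof -
  \<comment> \<open>The irrelevant variable is frozen at 0, so that the step structure holds for all
    real values of the other one; the original coefficients are independent of it only within
    \<open>{0..1}\<close>.\<close>
  define G where "G u v z =
      gamma_coeff (\<lambda>u v. x1 u 0) (\<lambda>u v. x2 u 0) (\<lambda>u v. y1 0 v) (\<lambda>u v. y2 0 v) u v * block_1 z +
      alpha_coeff (\<lambda>u v. x2 u 0) (\<lambda>u v. y1 0 v) u v \<bullet> block_2 z +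
      beta_coeff (\<lambda>u v. x1 u 0) (\<lambda>u v. y2 0 v) u v \<bullet> block_3 z" for u v and z :: "'d state"
  define Y where "Y v z = block_1 z *\<^sub>R y1 0 v + transpose (y2 0 v) *v block_3 z"
    for v and z :: "'d state"
  define X where "X u z = block_1 z *\<^sub>R x1 u 0 + transpose (x2 u 0) *v block_2 z"
    for u and z :: "'d state"
  \<comment> \<open>One constant for all kernels: \<open>K1\<close>, \<open>K2\<close>,
    \<open>K3\<close> serve \<open>G\<close>, \<open>K5\<close> and \<open>K7\<close> serve
    \<open>Y\<close>, \<open>K4\<close> and \<open>K6\<close> serve \<open>X\<close>. Absolute
    values make every summand nonnegative, so each partial sum is at most \<open>K\<close>.\<close>
  define K where "K = \<bar>K1\<bar> + \<bar>K2\<bar> + \<bar>K3\<bar> + \<bar>K4\<bar> + \<bar>K5\<bar> + \<bar>K6\<bar> + \<bar>K7\<bar>"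
  have x_const: "x1 u v = x1 u 0" "x2 u v = x2 u 0" if "u \<in> {0..1}" "v \<in> {0..1}" for u v
    using assms(3,4) that unfolding step_in_first_def constant_on_def
    by (metis atLeastAtMost_iff order_refl zero_le_one)+
  have y_const: "y1 u v = y1 0 v" "y2 u v = y2 0 v" if "u \<in> {0..1}" "v \<in> {0..1}" for u v
    using assms(5,6) that unfolding step_in_second_def step_in_first_def constant_on_def
    by (metis atLeastAtMost_iff order_refl zero_le_one)+
  have G_eq: "\<gamma> u v * block_1 z + \<alpha> u v \<bullet> block_2 z + \<beta> u v \<bullet> block_3 z = G u v z"
    and Y_eq: "block_1 z *\<^sub>R y1 u v + transpose (y2 u v) *v block_3 z = Y v z"
    and X_eq: "block_1 z *\<^sub>R x1 u v + transpose (x2 u v) *v block_2 z = X u z"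
    if "u \<in> {0..1}" "v \<in> {0..1}" for u v z
    using x_const[OF that] y_const[OF that]
    by (simp_all add: G_def Y_def X_def assms(8-10) alpha_coeff_def beta_coeff_def gamma_coeff_def)
  have x_step: "\<exists>c d. \<forall>u\<in>{p i<..<p (Suc i)}. x1 u 0 = c \<and> x2 u 0 = d" if "i < m" for i
    using assms(3,4) that unfolding step_in_first_def constant_on_def
    by (metis atLeastAtMost_iff order_refl zero_le_one)
  have y_step: "\<exists>c d. \<forall>v\<in>{q j<..<q (Suc j)}. y1 0 v = c \<and> y2 0 v = d" if "j < n" for j
    using assms(5,6) that unfolding step_in_second_def step_in_first_def constant_on_def
    by (metis atLeastAtMost_iff order_refl zero_le_one)
  have matrix_bound: "norm (transpose A *v z) \<le> B * norm z"
    if "antisymmetric_matrix A" "onorm ((*v) A) \<le> B" for A and z :: "real ^ 'd" and B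
    using norm_transpose_mult_antisymmetric[OF that(1), of z] mult_right_mono[OF that(2) norm_ge_zero[of z]]
    by linarith
  have coeff_bound: "\<bar>\<gamma> u v\<bar> \<le> \<bar>K1\<bar>" "norm (\<alpha> u v) \<le> \<bar>K2\<bar>" "norm (\<beta> u v) \<le> \<bar>K3\<bar>"
      "norm (x1 u v) \<le> \<bar>K4\<bar>" "norm (y1 u v) \<le> \<bar>K5\<bar>"
      "onorm ((*v) (x2 u v)) \<le> \<bar>K6\<bar>" "onorm ((*v) (y2 u v)) \<le> \<bar>K7\<bar>"
    if "u \<in> {0..1}" "v \<in> {0..1}" for u v
    using assms(12)[rule_format, OF that] by linarith+
  interpret goursat_system m n p q K G Y X
  proof (rule goursat_system.intro)
    show "partition01 m p" "partition01 n q" by fact+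
    show "0 \<le> K" by (simp add: K_def)
    show "bounded_linear (G u v)" "bounded_linear (Y v)" "bounded_linear (X u)" for u v
      unfolding G_def[abs_def] Y_def[abs_def] X_def[abs_def]
      by (intro bounded_linear_add bounded_linear_const_mult bounded_linear_inner_right_comp
          bounded_linear_scaleR_const bounded_linear_compose[OF matrix_vector_mul_bounded_linear]
          bounded_linear_block)+
    show "G constant_on {p i<..<p (Suc i)}" "X constant_on {p i<..<p (Suc i)}" if i: "i < m" for i
    proof -
      obtain c d where "\<forall>u\<in>{p i<..<p (Suc i)}. x1 u 0 = c \<and> x2 u 0 = d" using x_step[OF i] by blast
      then show "G constant_on {p i<..<p (Suc i)}" "X constant_on {p i<..<p (Suc i)}"
        unfolding constant_on_def G_def[abs_def] X_def[abs_def]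
          alpha_coeff_def beta_coeff_def gamma_coeff_def by auto
    qed
    show "G u constant_on {q j<..<q (Suc j)}" "Y constant_on {q j<..<q (Suc j)}" if j: "j < n" for u j
    proof -
      obtain c d where "\<forall>v\<in>{q j<..<q (Suc j)}. y1 0 v = c \<and> y2 0 v = d" using y_step[OF j] by blast
      then show "G u constant_on {q j<..<q (Suc j)}" "Y constant_on {q j<..<q (Suc j)}"
        unfolding constant_on_def G_def[abs_def] Y_def[abs_def]
          alpha_coeff_def beta_coeff_def gamma_coeff_def by auto
    qed
    show "norm (G u v z) \<le> K * norm z" if "u \<in> {0..1}" "v \<in> {0..1}" for u v z
    proof -
      have "\<bar>\<gamma> u v * block_1 z\<bar> \<le> \<bar>K1\<bar> * norm z"
        using mult_mono[OF coeff_bound(1)[OF that] norm_block_le(1)[of z]] by (simp add: abs_mult)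
      moreover have "\<bar>\<alpha> u v \<bullet> block_2 z\<bar> \<le> \<bar>K2\<bar> * norm z"
        using mult_mono[OF coeff_bound(2)[OF that] norm_block_le(2)[of z]]
        by (intro order_trans[OF Cauchy_Schwarz_ineq2]) simp
      moreover have "\<bar>\<beta> u v \<bullet> block_3 z\<bar> \<le> \<bar>K3\<bar> * norm z"
        using mult_mono[OF coeff_bound(3)[OF that] norm_block_le(3)[of z]]
        by (intro order_trans[OF Cauchy_Schwarz_ineq2]) simp
      moreover have "(\<bar>K1\<bar> + \<bar>K2\<bar> + \<bar>K3\<bar>) * norm z \<le> K * norm z"
        by (intro mult_right_mono) (auto simp: K_def)
      ultimately show ?thesis
        unfolding G_eq[OF that, symmetric] real_norm_def distrib_right by linarith
    qed
    show "norm (Y v z) \<le> K * norm z" if "v \<in> {0..1}" for v z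
    proof -
      have "norm (block_1 z *\<^sub>R y1 0 v) \<le> \<bar>K5\<bar> * norm z"
        using mult_mono[OF norm_block_le(1)[of z] coeff_bound(5)[of 0 v]] that
        by (simp add: mult.commute)
      moreover have "norm (transpose (y2 0 v) *v block_3 z) \<le> \<bar>K7\<bar> * norm (block_3 z)"
        using assms(7) coeff_bound(7)[of 0 v] that by (intro matrix_bound) auto
      moreover have "\<bar>K7\<bar> * norm (block_3 z) \<le> \<bar>K7\<bar> * norm z"
        by (intro mult_left_mono norm_block_le) simp
      moreover have "(\<bar>K5\<bar> + \<bar>K7\<bar>) * norm z \<le> K * norm z"
        by (intro mult_right_mono) (auto simp: K_def)
      ultimately show ?thesis
        unfolding Y_def distrib_right
        using norm_triangle_ineq[of "block_1 z *\<^sub>R y1 0 v" "transpose (y2 0 v) *v block_3 z"]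
        by linarith
    qed
    show "norm (X u z) \<le> K * norm z" if "u \<in> {0..1}" for u z
    proof -
      have "norm (block_1 z *\<^sub>R x1 u 0) \<le> \<bar>K4\<bar> * norm z"
        using mult_mono[OF norm_block_le(1)[of z] coeff_bound(4)[of u 0]] that
        by (simp add: mult.commute)
      moreover have "norm (transpose (x2 u 0) *v block_2 z) \<le> \<bar>K6\<bar> * norm (block_2 z)"
        using assms(7) coeff_bound(6)[of u 0] that by (intro matrix_bound) auto
      moreover have "\<bar>K6\<bar> * norm (block_2 z) \<le> \<bar>K6\<bar> * norm z"
        by (intro mult_left_mono norm_block_le) simp
      moreover have "(\<bar>K4\<bar> + \<bar>K6\<bar>) * norm z \<le> K * norm z"
        by (intro mult_right_mono) (auto simp: K_def)
      ultimately show ?thesis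
        unfolding X_def distrib_right
        using norm_triangle_ineq[of "block_1 z *\<^sub>R x1 u 0" "transpose (x2 u 0) *v block_2 z"]
        by linarith
    qed
  qed
  have op_eq: "integral_op \<gamma> \<alpha> \<beta> x1 x2 y1 y2 h z = goursat_op h z" if "z \<in> unit_square" for h z
    using that unfolding integral_op_def goursat_op_def
    by (auto intro!: integral_cong G_eq X_eq Y_eq simp del: transpose_matrix_vector)
  have "\<exists>!\<Phi>. \<Phi> \<in> C_square \<and> (\<forall>z\<in>unit_square. \<Phi> z - goursat_op \<Phi> z = h0 z)"
    by (rule ex1_solution) (simp add: assms(11))
  moreover have "(\<forall>z\<in>unit_square. \<Phi> z - integral_op \<gamma> \<alpha> \<beta> x1 x2 y1 y2 \<Phi> z = h0 z) \<longleftrightarrow>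
      (\<forall>z\<in>unit_square. \<Phi> z - goursat_op \<Phi> z = h0 z)" for \<Phi>
    using op_eq by (intro ball_cong) simp_all
  ultimately show ?thesis by simp
qed

end
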